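(* Consider a GS model given by a fixed choice of admissible parameters $(\mathbf X,\mathbf Y,\mathbf g,\psi^x,\psi^y)$ with technology set $\mathcal T$. Denote by $\mathcal D^*$ the set of efficiency scores $\theta_o^*$ achievable by units $(\mathbf x_o,\mathbf y_o)\in\mathcal T$. Assume that the path-flow mapping $\boldsymbol\phi(\mathbf x_o,\mathbf y_o;\theta^* )$ is strictly monotone on $\mathcal T$ at every $\theta^*\in\mathcal D^*$. If the model satisfies strong efficiency of projections (PR), then it satisfies strict monotonicity (MO).
   Context: Data and technology. $\mathbf X\in\mathbb R^{m\times n}$ and $\mathbf Y\in\mathbb R^{s\times n}$ are input and output data matrices (no sign restriction). With $\mathbf e$ the vector of ones, the technology set is $\mathcal T=\{(\mathbf x,\mathbf y)\in\mathbb R^m\times\mathbb R^s:\ \mathbf X\boldsymbol\lambda\le\mathbf x,\ \mathbf Y\boldsymbol\lambda\ge\mathbf y \text{ for some } \boldsymbol\lambda\ge 0,\ \mathbf e^\top\boldsymbol\lambda=1\}$. Elements of $\mathcal T$ are called units. Dominance. For points of $\mathbb R^m\times\mathbb R^s$, $(\mathbf x_o,\mathbf y_o)\succsim(\mathbf x_p,\mathbf y_p)$ (weakly dominates) means $\mathbf x_o\le\mathbf x_p$ and $\mathbf y_o\ge\mathbf y_p$ componentwise; $\succnsim$ (dominates) means in addition that the two points are distinct. A unit of $\mathcal T$ is strongly efficient if no other unit of $\mathcal T$ dominates it; the strongly efficient frontier $\partial^S\mathcal T$ is the set of strongly efficient units (a subset of the boundary $\partial\mathcal T$). GS model. $\mathbf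 g$ is a prescription assigning to each $(\mathbf x_o,\mathbf y_o)\in\mathcal T$ a direction $\mathbf g_o=(\mathbf g_o^x,\mathbf g_o^y)\in\mathbb R^m\times\mathbb R^s$ with $\mathbf g_o\ge 0$, $\mathbf g_o\ne 0$. The real functions $\psi^x,\psi^y$ satisfy: (A1) $\operatorname{dom}\psi^x=(a^x,\infty)$, $\operatorname{dom}\psi^y=(a^y,\infty)$ with $a^x,a^y\in\{-\infty,0\}$; (A2) $\psi^x$ is smooth, concave, (strictly) increasing and $\psi^y$ is smooth, convex, (strictly) decreasing; (A3) $\psi^x(1)=\psi^y(1)=1$; (A4) $\operatorname{im}\psi^x=(b^x,\infty)$ with $b^x=-\infty$ if $\mathbf g^y=0$ (i.e. $\mathbf g^y_o=0$ for all units) and $b^x\in\{-\infty,0\}$ otherwise, and $\operatorname{im}\psi^y=(b^y,\infty)$ with $b^y\in\{-\infty,0\}$. Such $(\mathbf X,\mathbf Y,\mathbf g,\psi^x,\psi^y)$ are called admissible parameters. Let $\mathcal D=\operatorname{dom}\psi^x\cap\operatorname{dom}\psi^y$ and, for $\theta\in\mathcal D$, $\boldsymbol\phi_o^x(\theta)=\mathbf x_o+(\psi^x(\theta)-1)\mathbf g_o^x$, $\boldsymbol\phi_o^y(\theta)=\mathbf y_o+(\psi^y(\theta)-1)\mathbf g_o^y$, $\boldsymbol\phi_o=(\boldsymbol\phi_o^x,\boldsymbol\phi_o^y)$ (the path of the unit). The programme $(GS)_o$ is: minimise $\theta$ over $(\boldsymbol\lambda,\theta)$, $\theta\in\mathcal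 D$, subject to $\mathbf X\boldsymbol\lambda\le\boldsymbol\phi_o^x(\theta)$, $\mathbf Y\boldsymbol\lambda\ge\boldsymbol\phi_o^y(\theta)$, $\mathbf e^\top\boldsymbol\lambda=1$, $\boldsymbol\lambda\ge0$. It is part of the setting that for each unit the minimum is attained; the optimal value $\theta_o^*\le1$ is the efficiency score of $(\mathbf x_o,\mathbf y_o)$ and $\boldsymbol\phi_o(\theta_o^* )\in\partial\mathcal T$ is its projection. Path-flow mapping. For fixed $\bar\theta\in\mathcal D$, the path-flow mapping $\boldsymbol\phi(\mathbf x_o,\mathbf y_o;\bar\theta)$ is the function $\mathcal T\to\mathbb R^{m+s}$, $(\mathbf x_o,\mathbf y_o)\mapsto\boldsymbol\phi_o(\bar\theta)$. It is monotone on $\mathcal T$ at $\bar\theta$ if for any two units, $(\mathbf x_o,\mathbf y_o)\succsim(\mathbf x_p,\mathbf y_p)$ implies $\boldsymbol\phi_o(\bar\theta)\succsim\boldsymbol\phi_p(\bar\theta)$. It is strictly monotone on $\mathcal T$ at $\bar\theta$ if, in addition, $(\mathbf x_o,\mathbf y_o)\succnsim(\mathbf x_p,\mathbf y_p)$ implies $\boldsymbol\phi_o(\bar\theta)\succnsim\boldsymbol\phi_p(\bar\theta)$. (MO) Strict monotonicity: whenever $(\mathbf x_o,\mathbf y_o)\succnsim(\mathbf x_p,\mathbf y_p)$ for two units of $\mathcal T$, one has $\theta_o^*>\theta_p^*$. (PR) Strong efficiency of projections: $\boldsymbol\phi_o(\theta_o^* )\in\partial^S\mathcal T$ for each $(\mathbf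 x_o,\mathbf y_o)\in\mathcal T$. *)

theory Defs
  imports "HOL-Analysis.Analysis"
begin

text \<open>Vectors carry the componentwise order of the library. The functions \<open>\<psi>\<^sup>x\<close>, \<open>\<psi>\<^sup>y\<close> are partial:
  each is a total HOL function together with the lower end point (\<open>a\<^sup>x\<close>, \<open>a\<^sup>y\<close>) of its domain,
  and its values outside that domain are never used. Likewise the direction prescription
  is only used on units of the technology set.\<close>

type_synonym ('m, 's) point = "(real ^ 'm) \<times> (real ^ 's)"

record ('m, 'n, 's) gs_params =
  inputs :: "real ^ 'n ^ 'm"
  outputs :: "real ^ 'n ^ 's"
  direction :: "('m, 's) point \<Rightarrow> ('m, 's) point"
  psi_x :: "real \<Rightarrow> real"
  lower_x :: ereal
  psi_y :: "real \<Rightarrow> real"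
  lower_y :: ereal

definition ray :: "ereal \<Rightarrow> real set" where
  "ray a = {t. a < ereal t}"

definition dom_x :: "('m::finite, 'n::finite, 's::finite) gs_params \<Rightarrow> real set" where
  "dom_x M = ray (lower_x M)"

definition dom_y :: "('m::finite, 'n::finite, 's::finite) gs_params \<Rightarrow> real set" where
  "dom_y M = ray (lower_y M)"

definition technology :: "('m::finite, 'n::finite, 's::finite) gs_params \<Rightarrow> ('m, 's) point set" where
  "technology M = {(x, y). \<exists>l. inputs M *v l \<le> x \<and> outputs M *v l \<ge> y \<and>
     l \<ge> 0 \<and> (\<Sum>j\<in>UNIV. l $ j) = 1}"

definition weakly_dominates :: "('m::finite, 's::finite) point \<Rightarrow> ('m, 's) point \<Rightarrow> bool" where
  "weakly_dominates p q \<longleftrightarrow> fst p \<le> fst q \<and> snd p \<ge> snd q"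

definition dominates :: "('m::finite, 's::finite) point \<Rightarrow> ('m, 's) point \<Rightarrow> bool" where
  "dominates p q \<longleftrightarrow> weakly_dominates p q \<and> p \<noteq> q"

definition strongly_efficient_frontier ::
    "('m::finite, 'n::finite, 's::finite) gs_params \<Rightarrow> ('m, 's) point set" where
  "strongly_efficient_frontier M = {p \<in> technology M. \<not> (\<exists>q \<in> technology M. dominates q p)}"

text \<open>Smoothness is continuous differentiability, the weakest usual meaning of the word. The two
  existential conjuncts constrain the lower end points \<open>b\<^sup>x\<close>, \<open>b\<^sup>y\<close> of the images of \<open>\<psi>\<^sup>x\<close>, \<open>\<psi>\<^sup>y\<close>.\<close>

definition admissible :: "('m::finite, 'n::finite, 's::finite) gs_params \<Rightarrow> bool" where
  "admissible M \<longleftrightarrow>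
     (\<forall>p \<in> technology M. fst (direction M p) \<ge> 0 \<and> snd (direction M p) \<ge> 0 \<and>
        direction M p \<noteq> 0) \<and>
     lower_x M \<in> {-\<infinity>, 0} \<and> lower_y M \<in> {-\<infinity>, 0} \<and>
     psi_x M C1_differentiable_on dom_x M \<and> concave_on (dom_x M) (psi_x M) \<and>
     strict_mono_on (dom_x M) (psi_x M) \<and>
     psi_y M C1_differentiable_on dom_y M \<and> convex_on (dom_y M) (psi_y M) \<and>
     strict_antimono_on (dom_y M) (psi_y M) \<and>
     psi_x M 1 = 1 \<and> psi_y M 1 = 1 \<and>
     (\<exists>b. psi_x M ` dom_x M = ray b \<and>
        (if \<forall>p \<in> technology M. snd (direction M p) = 0 then b = -\<infinity> else b \<in> {-\<infinity>, 0})) \<and>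
     (\<exists>b. psi_y M ` dom_y M = ray b \<and> b \<in> {-\<infinity>, 0})"

definition path_flow ::
    "('m::finite, 'n::finite, 's::finite) gs_params \<Rightarrow> ('m, 's) point \<Rightarrow> real \<Rightarrow> ('m, 's) point" where
  "path_flow M p \<theta> =
     (fst p + (psi_x M \<theta> - 1) *\<^sub>R fst (direction M p),
      snd p + (psi_y M \<theta> - 1) *\<^sub>R snd (direction M p))"

definition gs_feasible ::
    "('m::finite, 'n::finite, 's::finite) gs_params \<Rightarrow> ('m, 's) point \<Rightarrow> real ^ 'n \<Rightarrow> real \<Rightarrow> bool" where
  "gs_feasible M p l \<theta> \<longleftrightarrow> \<theta> \<in> dom_x M \<inter> dom_y M \<and>
     inputs M *v l \<le> fst (path_flow M p \<theta>) \<and> outputs M *v l \<ge> snd (path_flow M p \<theta>) \<and>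
     (\<Sum>j\<in>UNIV. l $ j) = 1 \<and> l \<ge> 0"

definition gs_minimum_attained ::
    "('m::finite, 'n::finite, 's::finite) gs_params \<Rightarrow> ('m, 's) point \<Rightarrow> bool" where
  "gs_minimum_attained M p \<longleftrightarrow>
     (\<exists>l \<theta>. gs_feasible M p l \<theta> \<and> (\<forall>l' \<theta>'. gs_feasible M p l' \<theta>' \<longrightarrow> \<theta> \<le> \<theta>'))"

text \<open>Admissibility alone does not force attainment (for instance when \<open>b\<^sup>x = 0\<close> and the
  output direction vanishes at some units only), so it is a separate part of the model.\<close>

definition gs_model :: "('m::finite, 'n::finite, 's::finite) gs_params \<Rightarrow> bool" where
  "gs_model M \<longleftrightarrow> admissible M \<and> (\<forall>p \<in> technology M. gs_minimum_attained M p)"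

definition efficiency_score ::
    "('m::finite, 'n::finite, 's::finite) gs_params \<Rightarrow> ('m, 's) point \<Rightarrow> real" where
  "efficiency_score M p = (LEAST \<theta>. \<exists>l. gs_feasible M p l \<theta>)"

definition achievable_scores :: "('m::finite, 'n::finite, 's::finite) gs_params \<Rightarrow> real set" where
  "achievable_scores M = efficiency_score M ` technology M"

definition path_flow_monotone_at ::
    "('m::finite, 'n::finite, 's::finite) gs_params \<Rightarrow> real \<Rightarrow> bool" where
  "path_flow_monotone_at M \<theta> \<longleftrightarrow>
     (\<forall>p \<in> technology M. \<forall>q \<in> technology M. weakly_dominates p q \<longrightarrow>
        weakly_dominates (path_flow M p \<theta>) (path_flow M q \<theta>))"

definition path_flow_strictly_monotone_at ::
    "('m::finite, 'n::finite, 's::finite) gs_params \<Rightarrow> real \<Rightarrow> bool" where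
  "path_flow_strictly_monotone_at M \<theta> \<longleftrightarrow> path_flow_monotone_at M \<theta> \<and>
     (\<forall>p \<in> technology M. \<forall>q \<in> technology M. dominates p q \<longrightarrow>
        dominates (path_flow M p \<theta>) (path_flow M q \<theta>))"

definition strict_monotonicity :: "('m::finite, 'n::finite, 's::finite) gs_params \<Rightarrow> bool" where
  "strict_monotonicity M \<longleftrightarrow>
     (\<forall>p \<in> technology M. \<forall>q \<in> technology M. dominates p q \<longrightarrow>
        efficiency_score M p > efficiency_score M q)"

definition strong_efficiency_of_projections ::
    "('m::finite, 'n::finite, 's::finite) gs_params \<Rightarrow> bool" where
  "strong_efficiency_of_projections M \<longleftrightarrow>
     (\<forall>p \<in> technology M. path_flow M p (efficiency_score M p) \<in> strongly_efficient_frontier M)"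

end

theory Submission
  imports Defs
begin

text \<open>Suppose that \<open>p\<close> dominates \<open>q\<close> but the score of \<open>p\<close> does not exceed the score of \<open>q\<close>.
  At the score of \<open>p\<close>, strict monotonicity of the path flow makes the projection of \<open>p\<close> dominate the
  point on the path of \<open>q\<close>, which in turn weakly dominates the projection of \<open>q\<close>, because points
  further down a path are better. So a unit dominates the projection of \<open>q\<close>, contrary to its
  strong efficiency.\<close>

lemma dominates_weakly_dominates_trans:
  assumes "dominates p q" "weakly_dominates q r"
  shows "dominates p r"
  using assms unfolding dominates_def weakly_dominates_def
  by (metis order.trans order.antisym prod_eq_iff)

text \<open>\<open>LEAST\<close> over the reals is informative only if a minimum exists. Attainment
  makes the score feasible, and feasibility includes the domain condition.\<close>

lemma efficiency_score_in_domain: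
  assumes "gs_minimum_attained M p"
  shows "efficiency_score M p \<in> dom_x M \<inter> dom_y M"
proof -
  obtain l \<theta> where feas: "gs_feasible M p l \<theta>" and min: "\<And>l' \<theta>'. gs_feasible M p l' \<theta>' \<Longrightarrow> \<theta> \<le> \<theta>'"
    using assms unfolding gs_minimum_attained_def by blast
  have "efficiency_score M p = \<theta>"
    unfolding efficiency_score_def by (rule Least_equality) (use feas min in blast)+
  with feas show ?thesis by (simp add: gs_feasible_def)
qed

text \<open>As directions are nonnegative, the smaller \<open>psi_x\<close> and larger
  \<open>psi_y\<close> at \<open>\<theta>\<close> give smaller inputs and larger outputs.\<close>

lemma path_flow_weakly_dominates:
  assumes "admissible M" "p \<in> technology M" "\<theta> \<le> \<theta>'"
    and "\<theta> \<in> dom_x M \<inter> dom_y M" "\<theta>' \<in> dom_x M \<inter> dom_y M"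
  shows "weakly_dominates (path_flow M p \<theta>) (path_flow M p \<theta>')"
proof -
  have g: "fst (direction M p) \<ge> 0" "snd (direction M p) \<ge> 0"
    and incr: "strict_mono_on (dom_x M) (psi_x M)"
    and decr: "strict_antimono_on (dom_y M) (psi_y M)"
    using assms unfolding admissible_def by blast+
  have "psi_x M \<theta> \<le> psi_x M \<theta>'"
    using strict_mono_on_leD[OF incr] assms by blast
  moreover have "psi_y M \<theta>' \<le> psi_y M \<theta>"
    using decr assms by (cases "\<theta> = \<theta>'") (auto simp: monotone_on_def less_le)
  ultimately show ?thesis
    using g by (auto simp: weakly_dominates_def path_flow_def less_eq_vec_def intro!: mult_right_mono)
qed

theorem corollary3p11:
  fixes M :: "('m::finite, 'n::finite, 's::finite) gs_params"
  assumes "gs_model M"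
    and "\<forall>\<theta> \<in> achievable_scores M. path_flow_strictly_monotone_at M \<theta>"
    and "strong_efficiency_of_projections M"
  shows "strict_monotonicity M"
  unfolding strict_monotonicity_def
proof (intro ballI impI, rule ccontr)
  fix p q
  assume p: "p \<in> technology M" and q: "q \<in> technology M" and "dominates p q"
    and "\<not> efficiency_score M p > efficiency_score M q"
  let ?\<theta> = "efficiency_score M p" and ?\<eta> = "efficiency_score M q"
  have "dominates (path_flow M p ?\<theta>) (path_flow M q ?\<theta>)"
    using assms(2) p q \<open>dominates p q\<close>
    by (simp add: achievable_scores_def path_flow_strictly_monotone_at_def)
  moreover have "weakly_dominates (path_flow M q ?\<theta>) (path_flow M q ?\<eta>)"
    using assms(1) p q \<open>\<not> ?\<theta> > ?\<eta>\<close> unfolding gs_model_def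
    by (intro path_flow_weakly_dominates efficiency_score_in_domain) auto
  ultimately have "dominates (path_flow M p ?\<theta>) (path_flow M q ?\<eta>)"
    by (rule dominates_weakly_dominates_trans)
  \<comment> \<open>Strong efficiency is used twice: at \<open>p\<close> it makes the projection a
    unit, at \<open>q\<close> it forbids that unit to dominate.\<close>
  then show False
    using assms(3) p q
    unfolding strong_efficiency_of_projections_def strongly_efficient_frontier_def by blast
qed

end
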